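(* Let $(\Sigma_t)$, $\Sigma_t=(\mathbf x(t),\mathbf p(t),B(t))$, be a (non-normalized) exchange pattern on a connected $n$-regular graph $\mathbf E$. For each vertex $t$ of $\mathbf E$ and each $e\in\operatorname{star}(t)$ put \[ \hat y_e(t)=\frac{p^+_e(t)}{p^-_e(t)}\prod_{f\in\operatorname{star}(t)}x_f(t)^{b_{fe}(t)} . \] Let $e$ be an edge of $\mathbf E$ connecting $t$ and $\overline t$, and let $f\mapsto\overline f$ be the associated bijection $\operatorname{star}(t)\to\operatorname{star}(\overline t)$ (with $\overline e=e$). Then \[ \hat y_{\overline f}(\overline t)= \begin{cases} \hat y_e(t)^{-1} & \text{if } f=e;\\ \hat y_f(t)\,\hat y_e(t)^{[b_{ef}(t)]_+}\,(\hat y_e(t)+1)^{-b_{ef}(t)} & \text{if } f\ne e, \end{cases} \] where $[b]_+=\max(b,0)$.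
   Context: Let $\mathbb P$ be an abelian multiplicative group without torsion, and $\mathcal F$ a field isomorphic to the field of rational functions in $n$ independent variables with coefficients in the integer group ring $\mathbb Z\mathbb P$. A **seed** is a triple $(\mathbf x,\mathbf p,B)$: the cluster $\mathbf x\subset\mathcal F$ is a set of $n$ algebraically independent elements (cluster variables) generating $\mathcal F$ over the fraction field of $\mathbb Z\mathbb P$; $\mathbf p=(p_x^\pm)_{x\in\mathbf x}$ is a $2n$-tuple of elements of $\mathbb P$; $B=(b_{xy})_{x,y\in\mathbf x}$ is a skew-symmetrizable $n\times n$ integer matrix. A seed $(\overline{\mathbf x},\overline{\mathbf p},\overline B)$ is related to $(\mathbf x,\mathbf p,B)$ by a **seed mutation** in direction $z\in\mathbf x$ if: - $\overline{\mathbf x}=\mathbf x-\{z\}\cup\{\overline z\}$, where $z\,\overline z=p_z^+\prod_{b_{xz}>0}x^{b_{xz}}+p_z^-\prod_{b_{xz}<0}x^{-b_{xz}}$; - $\overline p^\pm_{\overline z}=p^\mp_z$, and for $y\ne z$: $\overline p^+_y/\overline p^-_y=(p_z^+)^{b_{zy}}\,p_y^+/p_y^-$ if $b_{zy}\ge0$, and $\overline p^+_y/\overline p^-_y=(p_z^-)^{b_{zy}}\,p_y^+/p_y^-$ if $b_{zy}\le0$ (the individual $\overline p_y^\pm$ are not prescribed); - $\overline B$ is obtained by matrix mutation: $\overline b_{\overline z\overline z}=0$, $\overline b_{x\overline z}=-b_{xz}$, $\overline b_{\overline zy}=-b_{zy}$, and for $x,y\ne\overline z$, $\overline b_{xy}=b_{xy}+|b_{xz}|b_{zy}$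 if $b_{xz}b_{zy}\ge0$, $\overline b_{xy}=b_{xy}$ if $b_{xz}b_{zy}\le0$. For a vertex $t$ of $\mathbf E$, $\operatorname{star}(t)$ is the set of $n$ edges incident to $t$. An **exchange pattern** on $\mathbf E$ is a collection of seeds $\Sigma_t$ labeled by the vertices of $\mathbf E$, with the cluster variables of $\mathbf x(t)$ (hence coefficients and matrix rows/columns) labeled bijectively by $\operatorname{star}(t)$, written $x_e(t)$, $p_e^\pm(t)$, $b_{ef}(t)$, such that for every edge $e$ between $t$ and $\overline t$ the seed $\Sigma_{\overline t}$ is related to $\Sigma_t$ by mutation in direction $x_e(t)$, the new variable being $x_e(\overline t)$. For $f\in\operatorname{star}(t)\setminus\{e\}$, $\overline f\in\operatorname{star}(\overline t)\setminus\{e\}$ is the edge with $x_{\overline f}(\overline t)=x_f(t)$. *)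

theory Defs
  imports
    Complex_Main
    "HOL-Library.Poly_Mapping"
    "HOL-Computational_Algebra.Fraction_Field"
begin

section \<open>Torsion-free abelian groups and their integral group rings\<close>

class torsion_free_ab_group_mult = comm_monoid_mult + inverse +
  assumes group_left_inverse: "inverse a * a = 1"
    and group_divide_inverse: "a / b = a * inverse b"
    and torsion_free: "a ^ n = 1 \<Longrightarrow> 0 < n \<Longrightarrow> a = 1"

lemma group_right_inverse: "a * inverse a = (1::'a::torsion_free_ab_group_mult)"
  using group_left_inverse by (simp add: mult.commute)

lemma group_inverse_unique: "a * b = (1::'a::torsion_free_ab_group_mult) \<Longrightarrow> inverse a = b"
  by (metis group_left_inverse mult.assoc mult_1_left mult_1_right)

lemma group_inverse_inverse: "inverse (inverse a) = (a::'a::torsion_free_ab_group_mult)"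
  by (simp add: group_inverse_unique group_left_inverse)

lemma group_inverse_mult: "inverse (a * b) = inverse a * inverse (b::'a::torsion_free_ab_group_mult)"
  by (rule group_inverse_unique)
    (metis group_right_inverse mult.assoc mult.left_commute mult_1_right)

lemma group_inverse_one: "inverse 1 = (1::'a::torsion_free_ab_group_mult)"
  by (simp add: group_inverse_unique)

lemma group_inverse_power: "inverse (a ^ k) = inverse (a::'a::torsion_free_ab_group_mult) ^ k"
  by (induction k) (simp_all add: group_inverse_one group_inverse_mult)

definition pointed_submonoid :: "'a::torsion_free_ab_group_mult set \<Rightarrow> bool" where
  "pointed_submonoid M \<longleftrightarrow> 1 \<in> M \<and> (\<forall>x\<in>M. \<forall>y\<in>M. x * y \<in> M)
     \<and> (\<forall>x\<in>M. inverse x \<in> M \<longrightarrow> x = 1)"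

lemma pointed_submonoid_power: "pointed_submonoid M \<Longrightarrow> x \<in> M \<Longrightarrow> x ^ k \<in> M"
  by (induction k) (auto simp: pointed_submonoid_def)

lemma maximal_pointed_submonoid_power:
  assumes M: "pointed_submonoid M"
    and max: "\<And>N. pointed_submonoid N \<Longrightarrow> M \<subseteq> N \<Longrightarrow> N = M"
    and x: "x \<notin> M"
  shows "\<exists>k>0. inverse x ^ k \<in> M"
proof -
  define N where "N = {q * x ^ k | q k. q \<in> M}"
  have one: "1 \<in> M" and closed: "\<And>a b. a \<in> M \<Longrightarrow> b \<in> M \<Longrightarrow> a * b \<in> M"
    and pointed: "\<And>a. a \<in> M \<Longrightarrow> inverse a \<in> M \<Longrightarrow> a = 1"
    using M by (auto simp: pointed_submonoid_def)
  have "M \<subseteq> N"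
    unfolding N_def by (fastforce intro: exI[of _ 0])
  moreover have "x \<in> N"
    unfolding N_def using one by (auto intro!: exI[of _ 1])
  ultimately have "\<not> pointed_submonoid N"
    using max x by blast
  moreover have "1 \<in> N"
    using \<open>M \<subseteq> N\<close> one by blast
  moreover have "a * b \<in> N" if "a \<in> N" "b \<in> N" for a b
  proof -
    from that obtain q k r l where "q \<in> M" "r \<in> M" "a = q * x ^ k" "b = r * x ^ l"
      unfolding N_def by blast
    then have "a * b = (q * r) * x ^ (k + l)" and "q * r \<in> M"
      by (simp_all add: power_add ac_simps closed)
    then show ?thesis
      unfolding N_def by blast
  qed
  ultimately obtain y where "y \<in> N" "inverse y \<in> N" "y \<noteq> 1"
    unfolding pointed_submonoid_def by blast
  then obtain q k r l where q: "q \<in> M" "r \<in> M" and y: "y = q * x ^ k" "inverse y = r * x ^ l"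
    unfolding N_def by blast
  have "k + l > 0"
  proof (rule ccontr)
    assume "\<not> k + l > 0"
    then have "y \<in> M" "inverse y \<in> M"
      using q y by auto
    then show False
      using pointed \<open>y \<noteq> 1\<close> by blast
  qed
  moreover have "x ^ (k + l) * (q * r) = 1"
  proof -
    have "x ^ (k + l) * (q * r) = (q * x ^ k) * (r * x ^ l)"
      by (simp add: power_add ac_simps)
    also have "\<dots> = y * inverse y"
      by (metis y)
    finally show ?thesis
      by (simp add: group_right_inverse)
  qed
  then have "inverse x ^ (k + l) = q * r"
    by (metis group_inverse_power group_inverse_unique)
  ultimately show ?thesis
    using closed q by metis
qed

lemma ex_total_pointed_submonoid:
  "\<exists>M :: 'a::torsion_free_ab_group_mult set. pointed_submonoid M \<and> (\<forall>x. x \<in> M \<or> inverse x \<in> M)"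
proof -
  have "\<exists>M\<in>Collect pointed_submonoid :: 'a set set. \<forall>N\<in>Collect pointed_submonoid. M \<subseteq> N \<longrightarrow> N = M"
  proof (rule subset_Zorn_nonempty)
    show "Collect pointed_submonoid \<noteq> ({} :: 'a set set)"
      by (auto simp: pointed_submonoid_def intro!: exI[of _ "{1}"])
  next
    fix C :: "'a set set" assume C: "C \<noteq> {}" "subset.chain (Collect pointed_submonoid) C"
    have P: "pointed_submonoid X" if "X \<in> C" for X
      using C(2) that by (auto simp: subset_chain_def)
    have common: "\<exists>Z\<in>C. x \<in> Z \<and> y \<in> Z" if "x \<in> \<Union>C" "y \<in> \<Union>C" for x y
      using C(2) that unfolding subset_chain_def by blast
    have "1 \<in> \<Union>C"
      using C(1) P unfolding pointed_submonoid_def by blast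
    moreover have "x * y \<in> \<Union>C" if "x \<in> \<Union>C" "y \<in> \<Union>C" for x y
      using common[OF that] P unfolding pointed_submonoid_def by blast
    moreover have "x = 1" if "x \<in> \<Union>C" "inverse x \<in> \<Union>C" for x
      using common[OF that] P unfolding pointed_submonoid_def by blast
    ultimately show "\<Union>C \<in> Collect pointed_submonoid"
      unfolding pointed_submonoid_def by blast
  qed
  then obtain M :: "'a set" where M: "pointed_submonoid M"
    and max: "\<And>N. pointed_submonoid N \<Longrightarrow> M \<subseteq> N \<Longrightarrow> N = M"
    by blast
  have "x \<in> M \<or> inverse x \<in> M" for x
  proof (rule ccontr)
    assume x: "\<not> (x \<in> M \<or> inverse x \<in> M)"
    obtain k where k: "k > 0" "inverse x ^ k \<in> M"
      using maximal_pointed_submonoid_power[OF M max] x by blast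
    obtain l where l: "l > 0" "x ^ l \<in> M"
      using maximal_pointed_submonoid_power[OF M max, of "inverse x"] x
      by (auto simp: group_inverse_inverse)
    have "x ^ (l * k) \<in> M"
      using pointed_submonoid_power[OF M l(2)] by (simp add: power_mult)
    moreover have "inverse (x ^ (l * k)) \<in> M"
      using pointed_submonoid_power[OF M k(2), of l]
      by (simp add: group_inverse_power power_mult mult.commute[of l k])
    ultimately have "x ^ (l * k) = 1"
      using M by (auto simp: pointed_submonoid_def)
    then have "x = 1"
      using torsion_free[of x "l * k"] k l by simp
    then show False
      using x M by (auto simp: pointed_submonoid_def)
  qed
  then show ?thesis
    using M by blast
qed

text \<open>
  The convolution product on \<^typ>\<open>'a \<Rightarrow>\<^sub>0 int\<close> is indexed by an additive monoid, so the
  multiplicative group is first rewritten additively: \<open>Expo p\<close> is the exponent of the basis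
  element of the group ring given by \<open>p\<close>.
\<close>

datatype 'p expo = Expo (unExpo: 'p)

instantiation expo :: (torsion_free_ab_group_mult) ab_group_add
begin

definition zero_expo :: "'a expo" where
  "0 = Expo 1"

definition plus_expo :: "'a expo \<Rightarrow> 'a expo \<Rightarrow> 'a expo" where
  "a + b = Expo (unExpo a * unExpo b)"

definition uminus_expo :: "'a expo \<Rightarrow> 'a expo" where
  "- a = Expo (inverse (unExpo a))"

definition minus_expo :: "'a expo \<Rightarrow> 'a expo \<Rightarrow> 'a expo" where
  "a - b = Expo (unExpo a / unExpo b)"

instance
  by standard
    (auto simp: zero_expo_def plus_expo_def uminus_expo_def minus_expo_def ac_simps
      group_left_inverse group_right_inverse group_divide_inverse)

end

text \<open>
  A torsion-free abelian group admits a total order compatible with its operation. The choice of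
  one is auxiliary: it only serves to obtain from the library that the group ring and the polynomial
  rings over it are integral domains.
\<close>

definition positive_cone :: "'p::torsion_free_ab_group_mult set" where
  "positive_cone = (SOME M. pointed_submonoid M \<and> (\<forall>x. x \<in> M \<or> inverse x \<in> M))"

lemma positive_cone:
  "pointed_submonoid positive_cone" "x \<in> positive_cone \<or> inverse x \<in> positive_cone"
  using someI_ex[OF ex_total_pointed_submonoid] unfolding positive_cone_def by blast+

instantiation expo :: (torsion_free_ab_group_mult) linordered_ab_group_add
begin

definition less_eq_expo :: "'a expo \<Rightarrow> 'a expo \<Rightarrow> bool" where
  "a \<le> b \<longleftrightarrow> unExpo (b - a) \<in> positive_cone"

definition less_expo :: "'a expo \<Rightarrow> 'a expo \<Rightarrow> bool" where
  "a < b \<longleftrightarrow> a \<le> b \<and> \<not> b \<le> (a :: 'a expo)"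

instance
proof
  fix a b c :: "'a expo"
  have P: "unExpo x \<in> positive_cone \<Longrightarrow> unExpo y \<in> positive_cone
      \<Longrightarrow> unExpo (x + y) \<in> positive_cone"
    "unExpo (0 :: 'a expo) \<in> positive_cone"
    "unExpo x \<in> positive_cone \<Longrightarrow> unExpo (- x) \<in> positive_cone \<Longrightarrow> x = 0"
    "unExpo x \<in> positive_cone \<or> unExpo (- x) \<in> positive_cone" for x y :: "'a expo"
    using positive_cone(1) positive_cone(2)[of "unExpo x"]
    by (auto simp: pointed_submonoid_def zero_expo_def plus_expo_def uminus_expo_def
        intro!: expo.expand)
  show "a < b \<longleftrightarrow> a \<le> b \<and> \<not> b \<le> a"
    by (fact less_expo_def)
  show "a \<le> a"
    using P(2) by (simp add: less_eq_expo_def)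
  show "a \<le> c" if "a \<le> b" "b \<le> c"
    using P(1)[of "c - b" "b - a"] that by (simp add: less_eq_expo_def)
  show "a = b" if "a \<le> b" "b \<le> a"
    using P(3)[of "b - a"] that by (simp add: less_eq_expo_def)
  show "a \<le> b \<or> b \<le> a"
    using P(4)[of "b - a"] by (simp add: less_eq_expo_def)
  show "c + a \<le> c + b" if "a \<le> b"
    using that by (simp add: less_eq_expo_def)
qed

end

type_synonym 'p group_ring = "'p expo \<Rightarrow>\<^sub>0 int"

definition group_ring_of :: "'p \<Rightarrow> 'p::torsion_free_ab_group_mult group_ring" where
  "group_ring_of p = Poly_Mapping.single (Expo p) 1"


section \<open>Polynomials and rational functions\<close>

type_synonym ('v, 'r) mpoly = "('v \<Rightarrow>\<^sub>0 nat) \<Rightarrow>\<^sub>0 'r"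

definition mpoly_const :: "'r \<Rightarrow> ('v, 'r::zero) mpoly" where
  "mpoly_const c = Poly_Mapping.single 0 c"

definition mpoly_vars :: "('v, 'r::zero) mpoly \<Rightarrow> 'v set" where
  "mpoly_vars q = (\<Union>m\<in>Poly_Mapping.keys q. Poly_Mapping.keys m)"

definition mpoly_eval :: "('v \<Rightarrow> 'r) \<Rightarrow> ('v, 'r::comm_semiring_1) mpoly \<Rightarrow> 'r" where
  "mpoly_eval a q = (\<Sum>m\<in>Poly_Mapping.keys q. Poly_Mapping.lookup q m *
     (\<Prod>v\<in>Poly_Mapping.keys m. a v ^ Poly_Mapping.lookup m v))"

text \<open>
  The field of rational functions in \<open>n\<close> independent variables \<open>v\<^sub>0, \<dots>, v\<^bsub>n-1\<^esub>\<close> with coefficients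
  in the integral group ring, as a subfield of the rational functions in countably many variables.
\<close>

type_synonym 'p ratfun = "(nat, 'p group_ring) mpoly fract"

definition rational_functions :: "nat \<Rightarrow> 'p::torsion_free_ab_group_mult ratfun set" where
  "rational_functions n =
     {Fract a b | a b. b \<noteq> 0 \<and> mpoly_vars a \<subseteq> {..<n} \<and> mpoly_vars b \<subseteq> {..<n}}"

text \<open>
  The ambient field is the whole type \<^typ>\<open>'f\<close>; its structure as a field containing the group ring
  is the one transported along the isomorphism \<open>\<phi>\<close>.
\<close>

definition ambient_field_iso ::
  "nat \<Rightarrow> ('p::torsion_free_ab_group_mult ratfun \<Rightarrow> 'f::field) \<Rightarrow> bool" where
  "ambient_field_iso n \<phi> \<longleftrightarrow>
     bij_betw \<phi> (rational_functions n) UNIV \<and>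
     \<phi> 1 = 1 \<and>
     (\<forall>a\<in>rational_functions n. \<forall>b\<in>rational_functions n.
        \<phi> (a + b) = \<phi> a + \<phi> b \<and> \<phi> (a * b) = \<phi> a * \<phi> b)"

definition emb_ring ::
  "('p::torsion_free_ab_group_mult ratfun \<Rightarrow> 'f::field) \<Rightarrow> 'p group_ring \<Rightarrow> 'f" where
  "emb_ring \<phi> c = \<phi> (Fract (mpoly_const c) 1)"

definition emb ::
  "('p::torsion_free_ab_group_mult ratfun \<Rightarrow> 'f::field) \<Rightarrow> 'p \<Rightarrow> 'f" where
  "emb \<phi> p = emb_ring \<phi> (group_ring_of p)"

text \<open>The fraction field of the group ring inside the ambient field.\<close>

definition ground_field ::
  "('p::torsion_free_ab_group_mult ratfun \<Rightarrow> 'f::field) \<Rightarrow> 'f set" where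
  "ground_field \<phi> = {emb_ring \<phi> a / emb_ring \<phi> b | a b. b \<noteq> 0}"

definition is_subfield :: "'f::field set \<Rightarrow> bool" where
  "is_subfield K \<longleftrightarrow> 0 \<in> K \<and> 1 \<in> K \<and>
     (\<forall>a\<in>K. \<forall>b\<in>K. a + b \<in> K \<and> a * b \<in> K) \<and> (\<forall>a\<in>K. - a \<in> K \<and> inverse a \<in> K)"

definition algebraically_independent :: "'f::field set \<Rightarrow> 'f set \<Rightarrow> bool" where
  "algebraically_independent K X \<longleftrightarrow>
     (\<forall>q :: ('f, 'f) mpoly. mpoly_vars q \<subseteq> X \<longrightarrow> range (Poly_Mapping.lookup q) \<subseteq> K \<longrightarrow>
        mpoly_eval (\<lambda>x. x) q = 0 \<longrightarrow> q = 0)"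


section \<open>Seeds and seed mutation\<close>

text \<open>
  The components of a seed are indexed by the cluster variables themselves; the values of the
  coefficient and matrix functions outside the cluster are irrelevant.
\<close>

record ('f, 'p) seed =
  cluster :: "'f set"
  coeff_plus :: "'f \<Rightarrow> 'p"
  coeff_minus :: "'f \<Rightarrow> 'p"
  exch :: "'f \<Rightarrow> 'f \<Rightarrow> int"

definition skew_symmetrizable :: "'f set \<Rightarrow> ('f \<Rightarrow> 'f \<Rightarrow> int) \<Rightarrow> bool" where
  "skew_symmetrizable X B \<longleftrightarrow>
     (\<exists>d :: 'f \<Rightarrow> int. (\<forall>x\<in>X. d x > 0) \<and> (\<forall>x\<in>X. \<forall>y\<in>X. d x * B x y = - (d y * B y x)))"

definition is_seed ::
  "nat \<Rightarrow> ('p::torsion_free_ab_group_mult ratfun \<Rightarrow> 'f::field) \<Rightarrow> ('f, 'p) seed \<Rightarrow> bool" where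
  "is_seed n \<phi> S \<longleftrightarrow>
     finite (cluster S) \<and> card (cluster S) = n \<and>
     algebraically_independent (ground_field \<phi>) (cluster S) \<and>
     is_subfield hull (ground_field \<phi> \<union> cluster S) = UNIV \<and>
     skew_symmetrizable (cluster S) (exch S)"

definition exchange_relation ::
  "('p::torsion_free_ab_group_mult ratfun \<Rightarrow> 'f::field) \<Rightarrow> ('f, 'p) seed \<Rightarrow> 'f \<Rightarrow> 'f \<Rightarrow> bool" where
  "exchange_relation \<phi> S z z' \<longleftrightarrow>
     z * z' =
       emb \<phi> (coeff_plus S z) * (\<Prod>x\<in>{x \<in> cluster S. exch S x z > 0}. x powi exch S x z) +
       emb \<phi> (coeff_minus S z) * (\<Prod>x\<in>{x \<in> cluster S. exch S x z < 0}. x powi (- exch S x z))"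

definition coeff_mutation ::
  "('f, 'p::torsion_free_ab_group_mult) seed \<Rightarrow> 'f \<Rightarrow> 'f \<Rightarrow> ('f, 'p) seed \<Rightarrow> bool" where
  "coeff_mutation S z z' S' \<longleftrightarrow>
     coeff_plus S' z' = coeff_minus S z \<and> coeff_minus S' z' = coeff_plus S z \<and>
     (\<forall>y\<in>cluster S - {z}.
        (exch S z y \<ge> 0 \<longrightarrow> coeff_plus S' y / coeff_minus S' y =
           coeff_plus S z powi exch S z y * (coeff_plus S y / coeff_minus S y)) \<and>
        (exch S z y \<le> 0 \<longrightarrow> coeff_plus S' y / coeff_minus S' y =
           coeff_minus S z powi exch S z y * (coeff_plus S y / coeff_minus S y)))"

definition matrix_mutation ::
  "('f, 'p) seed \<Rightarrow> 'f \<Rightarrow> 'f \<Rightarrow> ('f, 'p) seed \<Rightarrow> bool" where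
  "matrix_mutation S z z' S' \<longleftrightarrow>
     exch S' z' z' = 0 \<and>
     (\<forall>x\<in>cluster S - {z}. exch S' x z' = - exch S x z) \<and>
     (\<forall>y\<in>cluster S - {z}. exch S' z' y = - exch S z y) \<and>
     (\<forall>x\<in>cluster S - {z}. \<forall>y\<in>cluster S - {z}.
        (exch S x z * exch S z y \<ge> 0 \<longrightarrow>
           exch S' x y = exch S x y + \<bar>exch S x z\<bar> * exch S z y) \<and>
        (exch S x z * exch S z y \<le> 0 \<longrightarrow> exch S' x y = exch S x y))"

definition seed_mutation ::
  "('p::torsion_free_ab_group_mult ratfun \<Rightarrow> 'f::field) \<Rightarrow>
     ('f, 'p) seed \<Rightarrow> 'f \<Rightarrow> 'f \<Rightarrow> ('f, 'p) seed \<Rightarrow> bool" where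
  "seed_mutation \<phi> S z z' S' \<longleftrightarrow>
     z \<in> cluster S \<and> cluster S' = cluster S - {z} \<union> {z'} \<and>
     exchange_relation \<phi> S z z' \<and> coeff_mutation S z z' S' \<and> matrix_mutation S z z' S'"


section \<open>Exchange patterns on regular graphs\<close>

text \<open>A graph has vertex set \<open>V\<close> and edge set \<open>E\<close>, an edge being the set of its two endpoints.\<close>

definition simple_graph :: "'v set \<Rightarrow> 'v set set \<Rightarrow> bool" where
  "simple_graph V E \<longleftrightarrow> (\<forall>e\<in>E. e \<subseteq> V \<and> card e = 2)"

definition star :: "'v set set \<Rightarrow> 'v \<Rightarrow> 'v set set" where
  "star E t = {e \<in> E. t \<in> e}"

definition regular_graph :: "nat \<Rightarrow> 'v set \<Rightarrow> 'v set set \<Rightarrow> bool" where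
  "regular_graph n V E \<longleftrightarrow> (\<forall>t\<in>V. finite (star E t) \<and> card (star E t) = n)"

definition connected_graph :: "'v set \<Rightarrow> 'v set set \<Rightarrow> bool" where
  "connected_graph V E \<longleftrightarrow> V \<noteq> {} \<and> (\<forall>s\<in>V. \<forall>t\<in>V. (s, t) \<in> {(u, v). {u, v} \<in> E}\<^sup>*)"

definition exchange_pattern ::
  "nat \<Rightarrow> ('p::torsion_free_ab_group_mult ratfun \<Rightarrow> 'f::field) \<Rightarrow> 'v set \<Rightarrow> 'v set set \<Rightarrow>
     ('v \<Rightarrow> ('f, 'p) seed) \<Rightarrow> ('v \<Rightarrow> 'v set \<Rightarrow> 'f) \<Rightarrow> bool" where
  "exchange_pattern n \<phi> V E \<Sigma> x \<longleftrightarrow>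
     (\<forall>t\<in>V. is_seed n \<phi> (\<Sigma> t) \<and> bij_betw (x t) (star E t) (cluster (\<Sigma> t))) \<and>
     (\<forall>t t'. {t, t'} \<in> E \<longrightarrow>
        seed_mutation \<phi> (\<Sigma> t) (x t {t, t'}) (x t' {t, t'}) (\<Sigma> t'))"

definition b_at ::
  "('v \<Rightarrow> ('f, 'p) seed) \<Rightarrow> ('v \<Rightarrow> 'v set \<Rightarrow> 'f) \<Rightarrow> 'v \<Rightarrow> 'v set \<Rightarrow> 'v set \<Rightarrow> int" where
  "b_at \<Sigma> x t e f = exch (\<Sigma> t) (x t e) (x t f)"

definition p_plus ::
  "('v \<Rightarrow> ('f, 'p) seed) \<Rightarrow> ('v \<Rightarrow> 'v set \<Rightarrow> 'f) \<Rightarrow> 'v \<Rightarrow> 'v set \<Rightarrow> 'p" where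
  "p_plus \<Sigma> x t e = coeff_plus (\<Sigma> t) (x t e)"

definition p_minus ::
  "('v \<Rightarrow> ('f, 'p) seed) \<Rightarrow> ('v \<Rightarrow> 'v set \<Rightarrow> 'f) \<Rightarrow> 'v \<Rightarrow> 'v set \<Rightarrow> 'p" where
  "p_minus \<Sigma> x t e = coeff_minus (\<Sigma> t) (x t e)"

definition y_hat ::
  "('p::torsion_free_ab_group_mult ratfun \<Rightarrow> 'f::field) \<Rightarrow> 'v set set \<Rightarrow>
     ('v \<Rightarrow> ('f, 'p) seed) \<Rightarrow> ('v \<Rightarrow> 'v set \<Rightarrow> 'f) \<Rightarrow> 'v \<Rightarrow> 'v set \<Rightarrow> 'f" where
  "y_hat \<phi> E \<Sigma> x t e =
     emb \<phi> (p_plus \<Sigma> x t e / p_minus \<Sigma> x t e) * (\<Prod>f\<in>star E t. x t f powi b_at \<Sigma> x t f e)"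

definition edge_bar ::
  "'v set set \<Rightarrow> ('v \<Rightarrow> 'v set \<Rightarrow> 'f) \<Rightarrow> 'v \<Rightarrow> 'v \<Rightarrow> 'v set \<Rightarrow> 'v set" where
  "edge_bar E x t t' f =
     (if f = {t, t'} then {t, t'} else (THE g. g \<in> star E t' - {{t, t'}} \<and> x t' g = x t f))"

end

theory Submission
  imports Defs
begin

text \<open>
  Everything happens inside a single seed mutation \<open>S \<rightarrow> S'\<close> that exchanges \<open>z\<close> for \<open>z'\<close>. Write
  \<open>P\<^sub>+, P\<^sub>-\<close> for the two coefficients at \<open>z\<close>, viewed in the field, and let
  \<open>M\<^sub>+ = \<Prod>\<^bsub>b\<^sub>x\<^sub>z > 0\<^esub> x^b\<^sub>x\<^sub>z\<close> and \<open>M\<^sub>- = \<Prod>\<^bsub>b\<^sub>x\<^sub>z < 0\<^esub> x^(-b\<^sub>x\<^sub>z)\<close>, so that \<open>\<Prod>x^b\<^sub>x\<^sub>z = M\<^sub>+ / M\<^sub>-\<close>. Then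
  \<open>y = (P\<^sub>+ M\<^sub>+) / (P\<^sub>- M\<^sub>-)\<close> is the hatted variable at \<open>z\<close>, and the exchange relation says exactly that
  \<open>y + 1 = z z' / (P\<^sub>- M\<^sub>-)\<close> (\<open>seed_y_hat_plus_one\<close>). At \<open>z'\<close> the mutation swaps the coefficients and
  negates the matrix column, which inverts \<open>y\<close> (\<open>seed_y_hat_mutated\<close>).

  For another cluster variable \<open>w\<close> put \<open>b = b\<^sub>z\<^sub>w\<close>. Comparing the hatted variable at \<open>w\<close> before and after
  the mutation, \<open>z^b\<close> is traded for \<open>z'^(-b)\<close>, while coefficient mutation together with matrix mutation
  contributes \<open>(P\<^sub>+ M\<^sub>+)^b\<close> if \<open>b \<ge> 0\<close> and \<open>(P\<^sub>- M\<^sub>-)^b\<close> if \<open>b \<le> 0\<close>: the sign of \<open>b\<close> selects the same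
  monomial of the exchange relation in both rules (\<open>rest_monomial_mutation\<close>). So the new variable is the old one multiplied by
  \<open>(P\<^sub>\<plusminus> M\<^sub>\<plusminus> / (z z'))^b\<close>, and this factor is \<open>(y / (y + 1))^b\<close> or \<open>(1 / (y + 1))^b\<close> respectively,
  which the exponent \<open>max b 0\<close> of \<open>y\<close> expresses uniformly (\<open>seed_y_hat_unmutated\<close>).

  All divisions are legitimate because elements of an algebraically independent set are nonzero
  (this also gives \<open>z' \<noteq> 0\<close>, hence \<open>y + 1 \<noteq> 0\<close>), and because the group embeds into the units of the
  field.
\<close>

section \<open>The coefficient group and the clusters inside the ambient field\<close>

lemma Fract_const_in_rational_functions:
  fixes c :: "'p::torsion_free_ab_group_mult group_ring"
  shows "Fract (mpoly_const c) 1 \<in> rational_functions n"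
proof -
  have "mpoly_vars (mpoly_const c) = {}" for c :: "'p group_ring"
    by (simp add: mpoly_vars_def mpoly_const_def)
  moreover have "(1 :: (nat, 'p group_ring) mpoly) = mpoly_const 1"
    by (simp add: mpoly_const_def)
  ultimately show ?thesis
    unfolding rational_functions_def
    by (metis (mono_tags, lifting) empty_subsetI mem_Collect_eq one_neq_zero)
qed

lemma emb_ring_add:
  assumes "ambient_field_iso n \<phi>"
  shows "emb_ring \<phi> (a + b) = emb_ring \<phi> a + emb_ring \<phi> b"
proof -
  have "Fract (mpoly_const (a + b)) 1 = Fract (mpoly_const a) 1 + Fract (mpoly_const b) 1"
    by (simp add: mpoly_const_def single_add)
  then show ?thesis
    using assms Fract_const_in_rational_functions unfolding ambient_field_iso_def emb_ring_def
    by metis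
qed

lemma emb_ring_mult:
  assumes "ambient_field_iso n \<phi>"
  shows "emb_ring \<phi> (a * b) = emb_ring \<phi> a * emb_ring \<phi> b"
proof -
  have "Fract (mpoly_const (a * b)) 1 = Fract (mpoly_const a) 1 * Fract (mpoly_const b) 1"
    by (simp add: mpoly_const_def mult_single)
  then show ?thesis
    using assms Fract_const_in_rational_functions unfolding ambient_field_iso_def emb_ring_def
    by metis
qed

lemma emb_ring_zero:
  assumes "ambient_field_iso n \<phi>"
  shows "emb_ring \<phi> 0 = 0"
  using emb_ring_add[OF assms, of 0 0] by (metis add_0_left add_cancel_right_right)

lemma emb_ring_one: "ambient_field_iso n \<phi> \<Longrightarrow> emb_ring \<phi> 1 = 1"
  by (simp add: emb_ring_def mpoly_const_def ambient_field_iso_def flip: One_fract_def)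

lemma emb_mult:
  assumes "ambient_field_iso n \<phi>"
  shows "emb \<phi> (a * b) = emb \<phi> a * emb \<phi> b"
  by (simp add: emb_def group_ring_of_def mult_single plus_expo_def flip: emb_ring_mult[OF assms])

lemma emb_one:
  assumes "ambient_field_iso n \<phi>"
  shows "emb \<phi> 1 = 1"
  by (simp add: emb_def group_ring_of_def emb_ring_one[OF assms] flip: zero_expo_def)

lemma emb_inverse_mult:
  assumes "ambient_field_iso n \<phi>"
  shows "emb \<phi> (inverse a) * emb \<phi> a = 1"
  by (simp add: group_left_inverse emb_one[OF assms] flip: emb_mult[OF assms])

lemma emb_nonzero:
  assumes "ambient_field_iso n \<phi>"
  shows "emb \<phi> a \<noteq> 0"
  using emb_inverse_mult[OF assms, of a] by force

lemma emb_inverse: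
  assumes "ambient_field_iso n \<phi>"
  shows "emb \<phi> (inverse a) = inverse (emb \<phi> a)"
  by (metis emb_inverse_mult[OF assms] inverse_unique mult.commute)

lemma emb_divide:
  assumes "ambient_field_iso n \<phi>"
  shows "emb \<phi> (a / b) = emb \<phi> a / emb \<phi> b"
  by (simp add: group_divide_inverse emb_mult[OF assms] emb_inverse[OF assms] divide_inverse)

lemma emb_powi:
  assumes "ambient_field_iso n \<phi>"
  shows "emb \<phi> (a powi k) = emb \<phi> a powi k"
proof -
  have "emb \<phi> (a ^ m) = emb \<phi> a ^ m" for a m
    by (induction m) (simp_all add: emb_one[OF assms] emb_mult[OF assms])
  then show ?thesis
    by (simp add: power_int_def emb_inverse[OF assms])
qed

text \<open>If \<open>0\<close> belonged to the set, the polynomial \<open>X\<^sub>0\<close> would be an algebraic relation.\<close>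

lemma algebraically_independent_nonzero:
  assumes indep: "algebraically_independent K X" and K: "0 \<in> K" "1 \<in> K" and "v \<in> X"
  shows "v \<noteq> 0"
proof
  assume "v = 0"
  define q :: "('a, 'a) mpoly" where "q = Poly_Mapping.single (Poly_Mapping.single v 1) 1"
  have "mpoly_vars q \<subseteq> X"
    using \<open>v \<in> X\<close> by (simp add: q_def mpoly_vars_def)
  moreover have "range (Poly_Mapping.lookup q) \<subseteq> K"
    using K by (auto simp: q_def lookup_single when_def)
  moreover have "mpoly_eval (\<lambda>x. x) q = 0"
    using \<open>v = 0\<close> by (simp add: q_def mpoly_eval_def)
  ultimately have "q = 0"
    using indep unfolding algebraically_independent_def by blast
  moreover have "Poly_Mapping.lookup q (Poly_Mapping.single v 1) = 1"
    by (simp add: q_def)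
  ultimately show False
    by simp
qed

lemma cluster_nonzero:
  assumes \<phi>: "ambient_field_iso n \<phi>" and "is_seed n \<phi> S" "v \<in> cluster S"
  shows "v \<noteq> 0"
proof (rule algebraically_independent_nonzero)
  show "algebraically_independent (ground_field \<phi>) (cluster S)" "v \<in> cluster S"
    using assms by (auto simp: is_seed_def)
  have "emb_ring \<phi> a \<in> ground_field \<phi>" for a
  proof -
    have "emb_ring \<phi> a = emb_ring \<phi> a / emb_ring \<phi> 1"
      by (simp add: emb_ring_one[OF \<phi>])
    then show ?thesis
      unfolding ground_field_def using one_neq_zero by blast
  qed
  then show "0 \<in> ground_field \<phi>" "1 \<in> ground_field \<phi>"
    using emb_ring_zero[OF \<phi>] emb_ring_one[OF \<phi>] by metis+
qed

lemma skew_symmetrizable_diagonal: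
  assumes "skew_symmetrizable X B" "z \<in> X"
  shows "B z z = 0"
proof -
  obtain d :: "'a \<Rightarrow> int" where "d z > 0" "d z * B z z = - (d z * B z z)"
    using assms unfolding skew_symmetrizable_def by blast
  then show ?thesis
    by simp
qed


section \<open>Hatted variables under a seed mutation\<close>

definition seed_y_hat ::
  "('p::torsion_free_ab_group_mult ratfun \<Rightarrow> 'f::field) \<Rightarrow> ('f, 'p) seed \<Rightarrow> 'f \<Rightarrow> 'f" where
  "seed_y_hat \<phi> S w =
     emb \<phi> (coeff_plus S w / coeff_minus S w) * (\<Prod>v\<in>cluster S. v powi exch S v w)"

definition plus_monomial :: "('f::field, 'p) seed \<Rightarrow> 'f \<Rightarrow> 'f" where
  "plus_monomial S z = (\<Prod>v\<in>{v \<in> cluster S. exch S v z > 0}. v powi exch S v z)"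

definition minus_monomial :: "('f::field, 'p) seed \<Rightarrow> 'f \<Rightarrow> 'f" where
  "minus_monomial S z = (\<Prod>v\<in>{v \<in> cluster S. exch S v z < 0}. v powi (- exch S v z))"

text \<open>
  With the exponents truncated by \<^const>\<open>max\<close>, both monomials range over the whole cluster, so that
  identities between products can be checked one factor at a time.
\<close>

lemma plus_monomial_max:
  assumes "finite (cluster S)"
  shows "plus_monomial S z = (\<Prod>v\<in>cluster S. v powi max (exch S v z) 0)"
  unfolding plus_monomial_def using assms
  by (intro prod.mono_neutral_cong_left) (auto simp: max_def split: if_splits)

lemma minus_monomial_max:
  assumes "finite (cluster S)"
  shows "minus_monomial S z = (\<Prod>v\<in>cluster S. v powi max (- exch S v z) 0)"
  unfolding minus_monomial_def using assms
  by (intro prod.mono_neutral_cong_left) (auto simp: max_def split: if_splits)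

lemma prod_powi: "prod g A powi k = (\<Prod>v\<in>A. g v powi k)" for g :: "'a \<Rightarrow> 'f::field"
  by (induction A rule: infinite_finite_induct) (simp_all add: power_int_mult_distrib)

locale mutation_of_seeds =
  fixes n :: nat and \<phi> :: "'p::torsion_free_ab_group_mult ratfun \<Rightarrow> 'f::field"
    and S S' :: "('f, 'p) seed" and z z' :: 'f
  assumes \<phi>: "ambient_field_iso n \<phi>"
    and seed: "is_seed n \<phi> S" and seed': "is_seed n \<phi> S'"
    and mutation: "seed_mutation \<phi> S z z' S'"
begin

abbreviation "rest \<equiv> cluster S - {z}"

lemma cluster_facts:
  "finite (cluster S)" "z \<in> cluster S" "cluster S' = insert z' rest" "exch S z z = 0"
  "z' \<noteq> 0" "\<And>v. v \<in> cluster S \<Longrightarrow> v \<noteq> 0"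
proof -
  show "finite (cluster S)" "z \<in> cluster S" "cluster S' = insert z' rest"
    using seed mutation by (auto simp: is_seed_def seed_mutation_def)
  then show "exch S z z = 0" "z' \<noteq> 0" "\<And>v. v \<in> cluster S \<Longrightarrow> v \<noteq> 0"
    using skew_symmetrizable_diagonal[of "cluster S" "exch S" z] seed
      cluster_nonzero[OF \<phi> seed] cluster_nonzero[OF \<phi> seed']
    by (auto simp: is_seed_def)
qed

text \<open>Both clusters have \<open>n\<close> elements, so the new variable cannot coincide with a surviving one.\<close>

lemma new_variable_notin_rest: "z' \<notin> rest"
proof
  assume "z' \<in> rest"
  then have "cluster S' = rest"
    using cluster_facts(3) by (simp add: insert_absorb)
  then have "card (cluster S') < card (cluster S)"
    using card_Diff1_less[OF cluster_facts(1,2)] by (simp only:)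
  then show False
    using seed seed' by (simp add: is_seed_def)
qed

lemma prod_cluster: "prod g (cluster S) = g z * prod g rest"
  using cluster_facts(1,2) by (rule prod.remove)

lemma prod_cluster': "prod g (cluster S') = g z' * prod g rest"
  using cluster_facts(1,3) new_variable_notin_rest by simp

lemma plus_monomial_rest: "plus_monomial S z = (\<Prod>v\<in>rest. v powi max (exch S v z) 0)"
  by (simp add: plus_monomial_max prod_cluster cluster_facts)

lemma minus_monomial_rest: "minus_monomial S z = (\<Prod>v\<in>rest. v powi max (- exch S v z) 0)"
  by (simp add: minus_monomial_max prod_cluster cluster_facts)

lemma monomials_nonzero: "plus_monomial S z \<noteq> 0" "minus_monomial S z \<noteq> 0"
  unfolding plus_monomial_rest minus_monomial_rest using cluster_facts by auto

lemma seed_y_hat_quotient: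
  "seed_y_hat \<phi> S z = (emb \<phi> (coeff_plus S z) * plus_monomial S z) /
     (emb \<phi> (coeff_minus S z) * minus_monomial S z)"
proof -
  have "(\<Prod>v\<in>cluster S. v powi exch S v z) = plus_monomial S z / minus_monomial S z"
    unfolding plus_monomial_max[OF cluster_facts(1)] minus_monomial_max[OF cluster_facts(1)]
      prod_dividef[symmetric]
  proof (rule prod.cong)
    fix v assume "v \<in> cluster S"
    then show "v powi exch S v z = v powi max (exch S v z) 0 / v powi max (- exch S v z) 0"
      by (simp add: max_def power_int_minus_divide)
  qed simp
  then show ?thesis
    by (simp add: seed_y_hat_def emb_divide[OF \<phi>])
qed

lemma seed_y_hat_plus_one:
  "seed_y_hat \<phi> S z + 1 = z * z' / (emb \<phi> (coeff_minus S z) * minus_monomial S z)"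
proof -
  have "z * z' = emb \<phi> (coeff_plus S z) * plus_monomial S z
      + emb \<phi> (coeff_minus S z) * minus_monomial S z"
    using mutation
    by (simp add: seed_mutation_def exchange_relation_def plus_monomial_def minus_monomial_def)
  then show ?thesis
    using monomials_nonzero emb_nonzero[OF \<phi>] by (simp add: seed_y_hat_quotient add_divide_distrib)
qed

text \<open>
  At the mutated variable, the coefficients are swapped and the column of the matrix changes sign;
  \<open>z\<close> and \<open>z'\<close> themselves do not enter because diagonal entries vanish.
\<close>

lemma seed_y_hat_mutated: "seed_y_hat \<phi> S' z' = inverse (seed_y_hat \<phi> S z)"
proof -
  have B': "exch S' z' z' = 0" "\<And>v. v \<in> rest \<Longrightarrow> exch S' v z' = - exch S v z"
    and p': "coeff_plus S' z' = coeff_minus S z" "coeff_minus S' z' = coeff_plus S z"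
    using mutation by (simp_all add: seed_mutation_def matrix_mutation_def coeff_mutation_def)
  have "(\<Prod>v\<in>rest. v powi exch S' v z') = inverse (\<Prod>v\<in>rest. v powi exch S v z)"
    by (simp add: B'(2) power_int_minus flip: prod_inversef)
  then show ?thesis
    by (simp add: seed_y_hat_def prod_cluster prod_cluster' B'(1) p' cluster_facts(4)
        emb_divide[OF \<phi>] divide_inverse)
qed

text \<open>
  The two sign cases of matrix mutation, read off columnwise: for fixed \<open>w\<close> the sign of \<open>b\<^sub>z\<^sub>w\<close> decides
  which of the two monomials of the exchange relation is multiplied in. For \<open>b\<^sub>z\<^sub>w = 0\<close> both cases apply
  and agree.
\<close>

lemma rest_monomial_mutation:
  assumes w: "w \<in> rest"
  shows "exch S z w \<ge> 0 \<Longrightarrow> (\<Prod>v\<in>rest. v powi exch S' v w) =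
           (\<Prod>v\<in>rest. v powi exch S v w) * plus_monomial S z powi exch S z w"
    and "exch S z w \<le> 0 \<Longrightarrow> (\<Prod>v\<in>rest. v powi exch S' v w) =
           (\<Prod>v\<in>rest. v powi exch S v w) * minus_monomial S z powi exch S z w"
proof -
  have B': "exch S v z * exch S z w \<ge> 0 \<Longrightarrow> exch S' v w = exch S v w + \<bar>exch S v z\<bar> * exch S z w"
    "exch S v z * exch S z w \<le> 0 \<Longrightarrow> exch S' v w = exch S v w" if "v \<in> rest" for v
    using mutation w that by (simp_all add: seed_mutation_def matrix_mutation_def)
  show "(\<Prod>v\<in>rest. v powi exch S' v w) =
      (\<Prod>v\<in>rest. v powi exch S v w) * plus_monomial S z powi exch S z w" if b: "exch S z w \<ge> 0"
    unfolding plus_monomial_rest prod_powi prod.distrib[symmetric]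
  proof (rule prod.cong)
    fix v assume v: "v \<in> rest"
    have "exch S' v w = exch S v w + max (exch S v z) 0 * exch S z w"
      using B'[OF v] b by (cases "exch S v z \<ge> 0") (auto simp: mult_nonpos_nonneg)
    then show "v powi exch S' v w = v powi exch S v w * (v powi max (exch S v z) 0) powi exch S z w"
      using v cluster_facts by (simp add: power_int_add power_int_mult)
  qed simp
  show "(\<Prod>v\<in>rest. v powi exch S' v w) =
      (\<Prod>v\<in>rest. v powi exch S v w) * minus_monomial S z powi exch S z w" if b: "exch S z w \<le> 0"
    unfolding minus_monomial_rest prod_powi prod.distrib[symmetric]
  proof (rule prod.cong)
    fix v assume v: "v \<in> rest"
    have "exch S' v w = exch S v w + max (- exch S v z) 0 * exch S z w"
      using B'[OF v] b
      by (cases "exch S v z \<ge> 0") (auto simp: mult_nonneg_nonpos mult_nonpos_nonpos)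
    then show "v powi exch S' v w = v powi exch S v w * (v powi max (- exch S v z) 0) powi exch S z w"
      using v cluster_facts by (simp add: power_int_add power_int_mult)
  qed simp
qed

text \<open>
  The factor \<open>z^b\<close> of the old variable becomes \<open>z'^(-b)\<close> in the new one, and the product \<open>z z'\<close> that
  arises in the quotient is absorbed by the exchange relation in the form of
  \<open>seed_y_hat_plus_one\<close>. The coefficient rule and the matrix rule split at the same sign of \<open>b\<close>, so
  each case involves a single monomial together with its own coefficient.
\<close>

lemma seed_y_hat_unmutated:
  assumes w: "w \<in> rest"
  shows "seed_y_hat \<phi> S' w = seed_y_hat \<phi> S w * seed_y_hat \<phi> S z powi max (exch S z w) 0 *
    (seed_y_hat \<phi> S z + 1) powi (- exch S z w)"
proof -
  define b R where "b = exch S z w" and "R = (\<Prod>v\<in>rest. v powi exch S v w)"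
  define P Q where "P = emb \<phi> (coeff_plus S z)" and "Q = emb \<phi> (coeff_minus S z)"
  define M N where "M = plus_monomial S z" and "N = minus_monomial S z"
  define c where "c = emb \<phi> (coeff_plus S w / coeff_minus S w)"
  note defs = b_def R_def P_def Q_def M_def N_def c_def
  have nz: "z \<noteq> 0" "z' \<noteq> 0" "P \<noteq> 0" "Q \<noteq> 0" "M \<noteq> 0" "N \<noteq> 0"
    using cluster_facts monomials_nonzero emb_nonzero[OF \<phi>] by (auto simp: defs)
  have "exch S' z' w = - b"
    using mutation w by (simp add: defs seed_mutation_def matrix_mutation_def)
  then have new: "seed_y_hat \<phi> S' w = emb \<phi> (coeff_plus S' w / coeff_minus S' w) *
      (z' powi (- b) * (\<Prod>v\<in>rest. v powi exch S' v w))"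
    by (simp add: seed_y_hat_def prod_cluster')
  have old: "seed_y_hat \<phi> S w = c * (z powi b * R)"
    by (simp add: seed_y_hat_def prod_cluster defs)
  have y: "seed_y_hat \<phi> S z = P * M / (Q * N)" "seed_y_hat \<phi> S z + 1 = z * z' / (Q * N)"
    unfolding defs by (fact seed_y_hat_quotient seed_y_hat_plus_one)+
  show ?thesis
  proof (cases "b \<ge> 0")
    case True
    then have "coeff_plus S' w / coeff_minus S' w =
        coeff_plus S z powi b * (coeff_plus S w / coeff_minus S w)"
      using mutation w by (simp add: defs seed_mutation_def coeff_mutation_def)
    then have "emb \<phi> (coeff_plus S' w / coeff_minus S' w) = P powi b * c"
      by (simp add: defs emb_mult[OF \<phi>] emb_powi[OF \<phi>])
    moreover have "(\<Prod>v\<in>rest. v powi exch S' v w) = R * M powi b"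
      using rest_monomial_mutation(1)[OF w] True by (simp add: defs)
    ultimately show ?thesis
      using True nz unfolding b_def[symmetric] y(2) unfolding new old y(1)
      by (simp add: max_def power_int_minus power_int_mult_distrib power_int_divide_distrib
          divide_simps)
  next
    case False
    then have "coeff_plus S' w / coeff_minus S' w =
        coeff_minus S z powi b * (coeff_plus S w / coeff_minus S w)"
      using mutation w by (simp add: defs seed_mutation_def coeff_mutation_def)
    then have "emb \<phi> (coeff_plus S' w / coeff_minus S' w) = Q powi b * c"
      by (simp add: defs emb_mult[OF \<phi>] emb_powi[OF \<phi>])
    moreover have "(\<Prod>v\<in>rest. v powi exch S' v w) = R * N powi b"
      using rest_monomial_mutation(2)[OF w] False by (simp add: defs)
    ultimately show ?thesis
      using False nz unfolding b_def[symmetric] y(2) unfolding new old y(1)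
      by (simp add: max_def power_int_minus power_int_mult_distrib power_int_divide_distrib
          divide_simps)
  qed
qed

end


section \<open>Exchange patterns\<close>

lemma y_hat_eq_seed_y_hat:
  assumes "bij_betw (x t) (star E t) (cluster (\<Sigma> t))"
  shows "y_hat \<phi> E \<Sigma> x t e = seed_y_hat \<phi> (\<Sigma> t) (x t e)"
  unfolding y_hat_def seed_y_hat_def p_plus_def p_minus_def b_at_def
  using prod.reindex_bij_betw[OF assms, of "\<lambda>v. v powi exch (\<Sigma> t) v (x t e)"] by simp

text \<open>
  The variable of \<open>f\<close> survives in the cluster at \<open>t'\<close> and differs from the new variable there, so it
  labels exactly one edge of \<open>star(t')\<close> other than \<open>{t, t'}\<close>, and the description defining
  \<^const>\<open>edge_bar\<close> denotes that edge.
\<close>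

lemma edge_bar_variable:
  assumes bij: "bij_betw (x t') (star E t') C'"
    and "f \<noteq> {t, t'}"
    and "x t f \<in> C'" "x t f \<noteq> x t' {t, t'}"
  shows "x t' (edge_bar E x t t' f) = x t f"
proof -
  obtain g where g: "g \<in> star E t'" "x t' g = x t f"
    using bij_betw_imp_surj_on[OF bij] \<open>x t f \<in> C'\<close> by (metis imageE)
  have "\<exists>!g. g \<in> star E t' - {{t, t'}} \<and> x t' g = x t f"
  proof (rule ex1I[of _ g])
    show "g \<in> star E t' - {{t, t'}} \<and> x t' g = x t f"
      using g \<open>x t f \<noteq> x t' {t, t'}\<close> by (metis Diff_iff singletonD)
    show "h = g" if "h \<in> star E t' - {{t, t'}} \<and> x t' h = x t f" for h
      using that g inj_onD[OF bij_betw_imp_inj_on[OF bij], of h g] by (metis Diff_iff)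
  qed
  then have "x t' (THE g. g \<in> star E t' - {{t, t'}} \<and> x t' g = x t f) = x t f"
    by (rule theI'[THEN conjunct2])
  then show ?thesis
    using \<open>f \<noteq> {t, t'}\<close> by (simp add: edge_bar_def)
qed

theorem proposition2p9:
  fixes n :: nat
    and \<phi> :: "'p::torsion_free_ab_group_mult ratfun \<Rightarrow> 'f::field"
    and V :: "'v set" and E :: "'v set set"
    and \<Sigma> :: "'v \<Rightarrow> ('f, 'p) seed"
    and x :: "'v \<Rightarrow> 'v set \<Rightarrow> 'f"
    and t t' :: 'v and e f :: "'v set"
  assumes "ambient_field_iso n \<phi>"
    and "simple_graph V E" and "connected_graph V E" and "regular_graph n V E"
    and "exchange_pattern n \<phi> V E \<Sigma> x"
    and "e \<in> E" and "e = {t, t'}"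
    and "f \<in> star E t"
  shows "y_hat \<phi> E \<Sigma> x t' (edge_bar E x t t' f) =
    (if f = e then inverse (y_hat \<phi> E \<Sigma> x t e)
     else y_hat \<phi> E \<Sigma> x t f * y_hat \<phi> E \<Sigma> x t e powi (max (b_at \<Sigma> x t e f) 0) *
       (y_hat \<phi> E \<Sigma> x t e + 1) powi (- b_at \<Sigma> x t e f))"
proof -
  have ends: "t \<in> V" "t' \<in> V" and edge: "e \<in> star E t" "e \<in> star E t'"
    using assms(2,6,7) by (auto simp: simple_graph_def star_def)
  have bij: "bij_betw (x t) (star E t) (cluster (\<Sigma> t))"
    and bij': "bij_betw (x t') (star E t') (cluster (\<Sigma> t'))"
    and seeds: "is_seed n \<phi> (\<Sigma> t)" "is_seed n \<phi> (\<Sigma> t')"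
    using assms(5) ends unfolding exchange_pattern_def by blast+
  have "seed_mutation \<phi> (\<Sigma> t) (x t e) (x t' e) (\<Sigma> t')"
    using assms(5,6) unfolding exchange_pattern_def assms(7) by blast
  with seeds interpret mutation_of_seeds n \<phi> "\<Sigma> t" "\<Sigma> t'" "x t e" "x t' e"
    using assms(1) by unfold_locales
  note y = y_hat_eq_seed_y_hat[where \<phi> = \<phi> and E = E and \<Sigma> = \<Sigma> and x = x, OF bij]
    y_hat_eq_seed_y_hat[where \<phi> = \<phi> and E = E and \<Sigma> = \<Sigma> and x = x, OF bij']
  show ?thesis
  proof (cases "f = e")
    case True
    then show ?thesis
      using seed_y_hat_mutated assms(7) by (simp add: y edge_bar_def)
  next
    case False
    then have f: "x t f \<in> cluster (\<Sigma> t) - {x t e}"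
      using bij_betw_apply[OF bij assms(8)] inj_onD[OF bij_betw_imp_inj_on[OF bij] _ assms(8) edge(1)]
      by blast
    have "x t' (edge_bar E x t t' f) = x t f"
    proof (rule edge_bar_variable[where x = x, OF bij'])
      show "x t f \<in> cluster (\<Sigma> t')"
        using f cluster_facts(3) by simp
      show "x t f \<noteq> x t' {t, t'}"
        using f new_variable_notin_rest assms(7) by auto
    qed (use False assms(7) in simp)
    then show ?thesis
      using seed_y_hat_unmutated[OF f] False by (simp add: y b_at_def)
  qed
qed

end
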